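(* Let $G(V,E)$ be a finite directed road network with set of centroids $Q\subseteq V$ and set of OD pairs $W=\{(s,t)\mid s,t\in Q,\ s\neq t\}$. Let $Z^*$ be the optimal objective value of the problem (CSP1) associated with $(G,Q,W)$, with all link costs $t_r=1$ (so that the objective counts the links on which counters are placed). Then $$Z^* \leq \sum_{s\in Q}\underline{d}(s)\qquad\text{and}\qquad Z^*\leq \sum_{t\in Q}\overline{d}(t).$$
   Context: $V$ is the node set and $E$ the set of directed links, each link being an ordered pair $(i,j)$ of distinct nodes $i,j\in V$. $Q\subseteq V$ is the set of centroids (origin and destination nodes). $\underline{d}(s)$ is the number of links of $E$ leaving node $s$; $\overline{d}(t)$ is the number of links of $E$ entering node $t$. For $(s,t)\in W$, an $(s,t)$-cut is a set $c\subseteq E$ of directed links such that after removing the links of $c$ from $G(V,E)$ there is no directed path from $s$ to $t$. $C^{st}=\{c_1^{st},\dots,c_{M(st)}^{st}\}$ is the set of all $(s,t)$-cuts, and $M(st)$ is their number. Problem (CSP1). Index all pairs (OD pair $(s,t)\in W$, cut $c_m^{st}\in C^{st}$) injectively by $l=\zeta(c_m^{st})\in N^L$, where $|N^L|=\sum_{(s,t)\in W}M(st)$; the same link set occurring as a cut for different OD pairs receives different indices. Index the links by a bijection $\eta:E\to N^R$, so $|N^R|=|E|$. Let $A\subseteq N^L\times N^R$ be the set of pairs $(l,r)$ such that $l=\zeta(c_m^{st})$, $r=\eta(i,j)$ and $(i,j)\in c_m^{st}$ for some $(s,t)\in W$, $c_m^{st}\in C^{st}$. With costs $t_r$ ($r\in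 N^R$), CSP1 is $$\min_{\mathbf{y},\mathbf{x}}\ \sum_{r\in N^R} t_r x_r$$ subject to $$y_l\leq x_r\quad\forall (l,r)\in A,$$ $$\sum_{l\in\{\zeta(c)\,:\,c\in C^{st}\}} y_l=1\quad\forall (s,t)\in W,$$ $$y_l\in\{0,1\}\ \ \forall l\in N^L,\qquad x_r\in\{0,1\}\ \ \forall r\in N^R.$$ Here $y_l=1$ means that the cut $l$ is selected, and $x_r=1$ means that a counter is placed on link $r$. *)

theory Defs
  imports Complex_Main "Graph_Theory.Pair_Digraph"
begin

definition od_pairs :: "'v set \<Rightarrow> ('v \<times> 'v) set" where
  "od_pairs Q = {(s, t). s \<in> Q \<and> t \<in> Q \<and> s \<noteq> t}"

definition remove_links :: "'v pair_pre_digraph \<Rightarrow> ('v \<times> 'v) set \<Rightarrow> 'v pair_pre_digraph" where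
  "remove_links G c = \<lparr> pverts = pverts G, parcs = parcs G - c \<rparr>"

text \<open>The cut sets are not required to be minimal; all disconnecting link sets are included.\<close>

definition st_cuts :: "'v pair_pre_digraph \<Rightarrow> 'v \<Rightarrow> 'v \<Rightarrow> ('v \<times> 'v) set set" where
  "st_cuts G s t =
     {c. c \<subseteq> parcs G \<and> \<not> (\<exists>p. pre_digraph.apath (with_proj (remove_links G c)) s p t)}"

text \<open>
  A cut is indexed together with its OD pair, so that one link set that is a cut for several
  OD pairs occurs several times in the index set of the cut variables.
\<close>

definition od_cuts ::
  "'v pair_pre_digraph \<Rightarrow> ('v \<times> 'v) set \<Rightarrow> (('v \<times> 'v) \<times> ('v \<times> 'v) set) set" where
  "od_cuts G W = {((s, t), c). (s, t) \<in> W \<and> c \<in> st_cuts G s t}"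

definition csp1_incidence ::
  "'v pair_pre_digraph \<Rightarrow> ('v \<times> 'v) set \<Rightarrow> (('v \<times> 'v) \<times> ('v \<times> 'v) set \<Rightarrow> 'l) \<Rightarrow>
   ('v \<times> 'v \<Rightarrow> 'r) \<Rightarrow> ('l \<times> 'r) set" where
  "csp1_incidence G W \<zeta> \<eta> =
     {(\<zeta> ((s, t), c), \<eta> (i, j)) | s t c i j. (s, t) \<in> W \<and> c \<in> st_cuts G s t \<and> (i, j) \<in> c}"

definition csp1_feasible ::
  "'v pair_pre_digraph \<Rightarrow> ('v \<times> 'v) set \<Rightarrow>
   (('v \<times> 'v) \<times> ('v \<times> 'v) set \<Rightarrow> 'l) \<Rightarrow> 'l set \<Rightarrow> ('v \<times> 'v \<Rightarrow> 'r) \<Rightarrow> 'r set \<Rightarrow>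
   (('l \<Rightarrow> real) \<times> ('r \<Rightarrow> real)) set" where
  "csp1_feasible G W \<zeta> NL \<eta> NR =
     {(y, x).
        (\<forall>(l, r) \<in> csp1_incidence G W \<zeta> \<eta>. y l \<le> x r) \<and>
        (\<forall>(s, t) \<in> W. (\<Sum>l \<in> {\<zeta> ((s, t), c) | c. c \<in> st_cuts G s t}. y l) = 1) \<and>
        (\<forall>l \<in> NL. y l \<in> {0, 1}) \<and>
        (\<forall>r \<in> NR. x r \<in> {0, 1})}"

definition csp1_objective :: "'r set \<Rightarrow> ('r \<Rightarrow> real) \<Rightarrow> ('r \<Rightarrow> real) \<Rightarrow> real" where
  "csp1_objective NR cost x = (\<Sum>r \<in> NR. cost r * x r)"

definition csp1_value ::
  "'v pair_pre_digraph \<Rightarrow> ('v \<times> 'v) set \<Rightarrow>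
   (('v \<times> 'v) \<times> ('v \<times> 'v) set \<Rightarrow> 'l) \<Rightarrow> 'l set \<Rightarrow> ('v \<times> 'v \<Rightarrow> 'r) \<Rightarrow> 'r set \<Rightarrow>
   ('r \<Rightarrow> real) \<Rightarrow> real" where
  "csp1_value G W \<zeta> NL \<eta> NR cost =
     (LEAST z. \<exists>(y, x) \<in> csp1_feasible G W \<zeta> NL \<eta> NR. z = csp1_objective NR cost x)"

lemma parcs_in_st_cuts:
  assumes "s \<noteq> t"
  shows "parcs G \<in> st_cuts G s t"
proof -
  have "\<not> pre_digraph.apath (with_proj (remove_links G (parcs G))) s p t" for p
    using assms
    by (cases p) (auto simp: pre_digraph.apath_def pre_digraph.awalk_def remove_links_def
        cas_with_proj_eq)
  then show ?thesis by (simp add: st_cuts_def)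
qed

text \<open>The minimum is attained, so the \<open>LEAST\<close> in \<open>csp1_value\<close> is a genuine optimal value.\<close>

lemma csp1_value_optimal:
  fixes G :: "'v pair_pre_digraph"
    and \<zeta> :: "('v \<times> 'v) \<times> ('v \<times> 'v) set \<Rightarrow> 'l"
    and \<eta> :: "'v \<times> 'v \<Rightarrow> 'r"
  assumes G: "pair_digraph G"
    and \<zeta>: "bij_betw \<zeta> (od_cuts G (od_pairs Q)) NL"
    and \<eta>: "bij_betw \<eta> (parcs G) NR"
  shows "\<exists>(y, x) \<in> csp1_feasible G (od_pairs Q) \<zeta> NL \<eta> NR.
           csp1_value G (od_pairs Q) \<zeta> NL \<eta> NR cost = csp1_objective NR cost x"
    and "(y, x) \<in> csp1_feasible G (od_pairs Q) \<zeta> NL \<eta> NR \<Longrightarrow>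
           csp1_value G (od_pairs Q) \<zeta> NL \<eta> NR cost \<le> csp1_objective NR cost x"
proof -
  let ?W = "od_pairs Q"
  let ?F = "csp1_feasible G ?W \<zeta> NL \<eta> NR"
  let ?P = "\<lambda>z. \<exists>(y, x) \<in> ?F. z = csp1_objective NR cost x"
  have finE: "finite (parcs G)" using G pair_fin_digraph.pair_finite_arcs pair_digraph_def by blast
  have finR: "finite NR" using finE \<eta> bij_betw_finite by blast
  have "{z. ?P z} \<subseteq> (\<lambda>S. sum cost S) ` Pow NR"
  proof
    fix z assume "z \<in> {z. ?P z}"
    then obtain y x where yx: "(y, x) \<in> ?F" and z: "z = csp1_objective NR cost x" by auto
    have x: "\<forall>r\<in>NR. x r \<in> {0, 1}" using yx by (auto simp: csp1_feasible_def)
    have "z = (\<Sum>r\<in>NR. if x r = 1 then cost r else 0)"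
      unfolding z csp1_objective_def using x by (intro sum.cong) auto
    also have "\<dots> = sum cost {r\<in>NR. x r = 1}"
      using finR by (simp add: sum.inter_filter)
    finally show "z \<in> (\<lambda>S. sum cost S) ` Pow NR" by blast
  qed
  then have fin: "finite {z. ?P z}" using finR by (meson finite_Pow_iff finite_imageI finite_subset)
  define y0 :: "'l \<Rightarrow> real" where "y0 l = (if l \<in> (\<lambda>w. \<zeta> (w, parcs G)) ` ?W then 1 else 0)" for l
  have "(y0, \<lambda>_. 1) \<in> ?F"
  proof -
    have inj: "inj_on \<zeta> (od_cuts G ?W)" using \<zeta> by (simp add: bij_betw_def)
    have E: "((s, t), parcs G) \<in> od_cuts G ?W" if "(s, t) \<in> ?W" for s t
      using that parcs_in_st_cuts by (auto simp: od_cuts_def od_pairs_def)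
    have "(\<Sum>l \<in> {\<zeta> ((s, t), c) | c. c \<in> st_cuts G s t}. y0 l) = 1" if st: "(s, t) \<in> ?W" for s t
    proof -
      let ?S = "{\<zeta> ((s, t), c) | c. c \<in> st_cuts G s t}"
      have "finite (st_cuts G s t)"
        by (rule finite_subset[of _ "Pow (parcs G)"]) (auto simp: st_cuts_def finE)
      then have finS: "finite ?S" by simp
      have in': "\<zeta> ((s, t), parcs G) \<in> ?S" using E[OF st] by (auto simp: od_cuts_def)
      have "y0 l = (if l = \<zeta> ((s, t), parcs G) then 1 else 0)" if l: "l \<in> ?S" for l
      proof -
        obtain c where c: "l = \<zeta> ((s, t), c)" "c \<in> st_cuts G s t" using l by blast
        have c': "((s, t), c) \<in> od_cuts G ?W" using c st by (simp add: od_cuts_def)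
        have "l \<in> (\<lambda>w. \<zeta> (w, parcs G)) ` ?W \<longleftrightarrow> c = parcs G"
        proof
          assume "l \<in> (\<lambda>w. \<zeta> (w, parcs G)) ` ?W"
          then obtain a b where ab: "(a, b) \<in> ?W" "l = \<zeta> ((a, b), parcs G)" by auto
          then show "c = parcs G" using inj_onD[OF inj _ c' E[OF ab(1)]] c by simp
        qed (use c st in auto)
        moreover have "l = \<zeta> ((s, t), parcs G) \<longleftrightarrow> c = parcs G"
          using inj_onD[OF inj _ c' E[OF st]] c by auto
        ultimately show ?thesis by (simp add: y0_def)
      qed
      then have "(\<Sum>l\<in>?S. y0 l) = (\<Sum>l\<in>?S. if l = \<zeta> ((s, t), parcs G) then 1 else 0)"
        by (intro sum.cong) auto
      also have "\<dots> = 1" using finS in' by simp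
      finally show ?thesis .
    qed
    then show ?thesis by (auto simp: csp1_feasible_def y0_def)
  qed
  then have ex: "\<exists>z. ?P z" by blast
  have val: "csp1_value G ?W \<zeta> NL \<eta> NR cost = Min {z. ?P z}"
    unfolding csp1_value_def by (rule Least_Min[OF fin ex])
  show "\<exists>(y, x) \<in> ?F. csp1_value G ?W \<zeta> NL \<eta> NR cost = csp1_objective NR cost x"
    using Min_in[OF fin] ex unfolding val by blast
  show "csp1_value G ?W \<zeta> NL \<eta> NR cost \<le> csp1_objective NR cost x" if "(y, x) \<in> ?F"
    unfolding val using that by (intro Min_le[OF fin]) auto
qed

end

theory Submission
  imports Defs
begin

text \<open>
  All links leaving an origin \<open>s\<close> form an \<open>(s, t)\<close>-cut for every destination
  \<open>t \<noteq> s\<close>, because a path from \<open>s\<close> to another node has a first link, and that link leaves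
  \<open>s\<close>. Putting a counter on every link that leaves a centroid therefore covers one cut for each
  OD pair. The number of these links is at most the sum of the out-degrees of the centroids. The
  links entering the destinations give the second bound in the same way, through the last link
  of a path.

  Both arguments rest on one principle (\<open>csp1_value_le_card\<close>): if a set \<open>F\<close> of links contains
  a cut for every OD pair, then counters on \<open>F\<close> are feasible, so the optimum is at most
  \<open>card F\<close>.
\<close>

text \<open>
  A selection \<open>k\<close> of cuts becomes a feasible point: \<open>y\<close> marks the indices of the selected pairs
  and \<open>x\<close> marks \<open>F\<close>. Injectivity of \<open>\<zeta>\<close> is what makes this work, since it keeps an index
  selected for one OD pair from being read as a cut of another.
\<close>

lemma csp1_value_le_card:
  fixes \<zeta> :: "('v \<times> 'v) \<times> ('v \<times> 'v) set \<Rightarrow> 'l"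
    and \<eta> :: "'v \<times> 'v \<Rightarrow> 'r"
  assumes G: "pair_digraph G"
    and \<zeta>: "bij_betw \<zeta> (od_cuts G (od_pairs Q)) NL"
    and \<eta>: "bij_betw \<eta> (parcs G) NR"
    and F: "F \<subseteq> parcs G"
    and cut: "\<And>s t. (s, t) \<in> od_pairs Q \<Longrightarrow> k (s, t) \<in> st_cuts G s t"
    and sub: "\<And>s t. (s, t) \<in> od_pairs Q \<Longrightarrow> k (s, t) \<subseteq> F"
  shows "csp1_value G (od_pairs Q) \<zeta> NL \<eta> NR (\<lambda>_. 1) \<le> real (card F)"
proof -
  let ?W = "od_pairs Q"
  define y :: "'l \<Rightarrow> real" where "y l = of_bool (l \<in> (\<lambda>w. \<zeta> (w, k w)) ` ?W)" for l
  define x :: "'r \<Rightarrow> real" where "x r = of_bool (r \<in> \<eta> ` F)" for r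
  have finE: "finite (parcs G)"
    using G pair_fin_digraph.pair_finite_arcs pair_digraph_def by blast
  have finR: "finite NR" using finE \<eta> bij_betw_finite by blast
  have inj: "inj_on \<zeta> (od_cuts G ?W)" using \<zeta> by (simp add: bij_betw_def)
  have selected: "\<zeta> ((s, t), c) \<in> (\<lambda>w. \<zeta> (w, k w)) ` ?W \<longleftrightarrow> c = k (s, t)"
    if st: "(s, t) \<in> ?W" and c: "c \<in> st_cuts G s t" for s t c
  proof
    assume "\<zeta> ((s, t), c) \<in> (\<lambda>w. \<zeta> (w, k w)) ` ?W"
    then obtain a b where ab: "(a, b) \<in> ?W" "\<zeta> ((s, t), c) = \<zeta> ((a, b), k (a, b))" by auto
    then have "((s, t), c) = ((a, b), k (a, b))"
      using st c cut by (intro inj_onD[OF inj]) (auto simp: od_cuts_def)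
    then show "c = k (s, t)" by simp
  qed (use st in auto)
  have "(\<Sum>l \<in> {\<zeta> ((s, t), c) | c. c \<in> st_cuts G s t}. y l) = 1" if st: "(s, t) \<in> ?W" for s t
  proof -
    have fin: "finite (st_cuts G s t)"
      by (rule finite_subset[of _ "Pow (parcs G)"]) (auto simp: st_cuts_def finE)
    have "inj_on (\<lambda>c. \<zeta> ((s, t), c)) (st_cuts G s t)"
      using st by (auto simp: inj_on_def od_cuts_def dest: inj_onD[OF inj])
    then have "(\<Sum>l \<in> {\<zeta> ((s, t), c) | c. c \<in> st_cuts G s t}. y l)
        = (\<Sum>c \<in> st_cuts G s t. y (\<zeta> ((s, t), c)))"
      by (simp add: Setcompr_eq_image sum.reindex)
    also have "\<dots> = (\<Sum>c \<in> st_cuts G s t. if c = k (s, t) then 1 else 0)"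
      using selected[OF st] by (intro sum.cong) (auto simp: y_def)
    also have "\<dots> = 1" using fin cut[OF st] by simp
    finally show ?thesis .
  qed
  moreover have "y l \<le> x r" if lr: "(l, r) \<in> csp1_incidence G ?W \<zeta> \<eta>" for l r
  proof -
    obtain s t c i j where *: "l = \<zeta> ((s, t), c)" "r = \<eta> (i, j)" "(s, t) \<in> ?W"
        "c \<in> st_cuts G s t" "(i, j) \<in> c"
      using lr unfolding csp1_incidence_def by blast
    show ?thesis
    proof (cases "c = k (s, t)")
      case True
      then have "r \<in> \<eta> ` F" using * sub by blast
      then show ?thesis by (simp add: x_def y_def)
    next
      case False
      then show ?thesis using selected[OF *(3,4)] *(1) by (simp add: x_def y_def)
    qed
  qed
  ultimately have feasible: "(y, x) \<in> csp1_feasible G ?W \<zeta> NL \<eta> NR"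
    by (auto simp: csp1_feasible_def x_def y_def)
  have "\<eta> ` F \<subseteq> NR" using F \<eta> by (auto simp: bij_betw_def)
  then have "csp1_objective NR (\<lambda>_. 1) x = card (\<eta> ` F)"
    using finR by (simp add: csp1_objective_def x_def of_bool_def sum.If_cases Int_absorb1)
  also have "\<dots> = card F"
    using inj_on_subset[OF bij_betw_imp_inj_on[OF \<eta>] F] by (simp add: card_image)
  finally show ?thesis using csp1_value_optimal(2)[OF G \<zeta> \<eta> feasible, of "\<lambda>_. 1"] by simp
qed

lemma cas_first_arc:
  assumes "pre_digraph.cas G u p v" "u \<noteq> v"
  shows "\<exists>e \<in> set p. tail G e = u"
  using assms by (cases p) (auto simp: pre_digraph.cas.simps)

lemma cas_last_arc:
  assumes "pre_digraph.cas G u p v" "u \<noteq> v"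
  shows "\<exists>e \<in> set p. head G e = v"
  using assms
proof (induction p arbitrary: u)
  case (Cons e p)
  then show ?case by (cases "head G e = v") (auto simp: pre_digraph.cas.simps)
qed (simp add: pre_digraph.cas.simps)

lemma out_arcs_in_st_cuts:
  assumes "s \<noteq> t"
  shows "out_arcs (with_proj G) s \<in> st_cuts G s t"
  using assms
  by (auto simp: st_cuts_def pre_digraph.apath_def pre_digraph.awalk_def remove_links_def
      dest!: cas_first_arc)

lemma in_arcs_in_st_cuts:
  assumes "s \<noteq> t"
  shows "in_arcs (with_proj G) t \<in> st_cuts G s t"
  using assms
  by (auto simp: st_cuts_def pre_digraph.apath_def pre_digraph.awalk_def remove_links_def
      dest!: cas_last_arc)

theorem proposition1:
  fixes G :: "'v pair_pre_digraph"
    and Q :: "'v set"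
    and \<zeta> :: "('v \<times> 'v) \<times> ('v \<times> 'v) set \<Rightarrow> 'l"
    and \<eta> :: "'v \<times> 'v \<Rightarrow> 'r"
    and NL :: "'l set"
    and NR :: "'r set"
  assumes "pair_digraph G"
    and "Q \<subseteq> pverts G"
    and "bij_betw \<zeta> (od_cuts G (od_pairs Q)) NL"
    and "bij_betw \<eta> (parcs G) NR"
  shows "csp1_value G (od_pairs Q) \<zeta> NL \<eta> NR (\<lambda>_. 1)
           \<le> real (\<Sum>s \<in> Q. out_degree (with_proj G) s) \<and>
         csp1_value G (od_pairs Q) \<zeta> NL \<eta> NR (\<lambda>_. 1)
           \<le> real (\<Sum>t \<in> Q. in_degree (with_proj G) t)"
proof -
  let ?Z = "csp1_value G (od_pairs Q) \<zeta> NL \<eta> NR (\<lambda>_. 1)"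
  let ?out = "\<lambda>s. out_arcs (with_proj G) s" and ?in = "\<lambda>t. in_arcs (with_proj G) t"
  have finQ: "finite Q"
    using assms(1,2) finite_subset pair_fin_digraph.pair_finite_verts pair_digraph_def by blast
  have "?Z \<le> real (card (\<Union>s \<in> Q. ?out s))"
    by (rule csp1_value_le_card[OF assms(1,3,4), where k = "\<lambda>(s, t). ?out s"])
      (use out_arcs_in_st_cuts in \<open>auto simp: od_pairs_def\<close>)
  also have "\<dots> \<le> real (\<Sum>s \<in> Q. out_degree (with_proj G) s)"
    unfolding out_degree_def by (rule of_nat_mono[OF card_UN_le[OF finQ]])
  finally have 1: "?Z \<le> real (\<Sum>s \<in> Q. out_degree (with_proj G) s)" .
  have "?Z \<le> real (card (\<Union>t \<in> Q. ?in t))"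
    by (rule csp1_value_le_card[OF assms(1,3,4), where k = "\<lambda>(s, t). ?in t"])
      (use in_arcs_in_st_cuts in \<open>auto simp: od_pairs_def\<close>)
  also have "\<dots> \<le> real (\<Sum>t \<in> Q. in_degree (with_proj G) t)"
    unfolding in_degree_def by (rule of_nat_mono[OF card_UN_le[OF finQ]])
  finally show ?thesis using 1 by blast
qed

end
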